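(* Let $A$ be a decomposable PAC uniformly stable randomized algorithm (with sample size $N$, sample space $Z$, data distribution $\mathcal{D}$ and loss $\ell$). Let $\varepsilon\in(0,1)$, and let $\delta>0$ be the constant associated with $\varepsilon$ in the definition of (decomposable) PAC uniform stability, i.e. $\delta>0$ and $D_\varepsilon = B_\varepsilon^{N+1}\subset Z^{N+1}$ (with $B_\varepsilon\subset Z$) are such that $D_\varepsilon$ has probability at least $1-\varepsilon$ and the stability inequality holds on $D_\varepsilon$ with $\delta$. Then there exists an event $C_\varepsilon\subset Z^N$ which occurs with probability at least $1-\varepsilon$ (under $\mathcal{D}^N$) such that $$\left|\hat{\mathbb{E}}_S\,\mathbb{E}_A\left[R_S[A(S)]-\hat R[A(S)]\right]\right|<\delta,$$ where $\hat{\mathbb{E}}_S$ is the conditional expectation over $S\sim\mathcal{D}^N$ given $S\in C_\varepsilon$, and $\hat R$ is the conditional generalization error under the condition $C_\varepsilon$.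
   Context: Setting: $Z$ is a sample space with a probability distribution $\mathcal{D}$; $S=(\bm t_1,\dots,\bm t_N)$ denotes a sample of $N$ examples drawn i.i.d. from $\mathcal{D}$. A (potentially) randomized algorithm $A$ maps a sample $S\in Z^N$ to a random model parameter $A(S)$; $\mathbb{E}_A$ denotes expectation over the internal randomness of $A$. $\ell(\bm P;\bm t)\in\mathbb{R}$ is the loss of the model with parameter $\bm P$ at $\bm t\in Z$. All functions are assumed measurable and all expectations involved are assumed to exist. Empirical error: $R_S[\bm P]=\frac1N\sum_{n=1}^N\ell(\bm P;\bm t_n)$ for $S=(\bm t_1,\dots,\bm t_N)$. Conditional generalization error under an event $C\subset Z^N$ of positive probability: $\hat R[\bm P]=\mathbb{E}_{(\bm t_1,\dots,\bm t_N)\sim\mathcal{D}^N_C}\left[\frac1N\sum_{i=1}^N\ell(\bm P;\bm t_i)\right]$, where $\mathcal{D}^N_C$ is the distribution $\mathcal{D}^N$ conditioned on $C$. PAC uniform stability: $A$ is PAC uniformly stable if for any $\varepsilon\in(0,1)$ there exist $\delta>0$ and an event $D_\varepsilon\subset Z^{N+1}$ which occurs with probability at least $1-\varepsilon$ (under $\mathcal{D}^{N+1}$) such that $$\sup_{\bm t\in Z}\mathbb{E}_A\left[\left|\ell(A(S);\bm t)-\ell(A(S');\bm t)\right|\right]<\delta$$ for all samples $S=(\bm t_1,\dots,\bm t_N)$ and $S'=(\bm t_1,\dots,\bm t_{i-1},\bm t_i',\bm t_{i+1},\dots,\bm t_N)$ differing in at most one example (the $i$th, for any $i\in\{1,\dots,N\}$)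 and satisfying $(\bm t_1,\dots,\bm t_i,\bm t_i',\bm t_{i+1},\dots,\bm t_N)\in D_\varepsilon$. A PAC uniformly stable $A$ is decomposable if for any $\varepsilon\in(0,1)$ there is an event $B_\varepsilon\subset Z$ such that $D_\varepsilon=B_\varepsilon^{N+1}$. *)

theory Defs
  imports "HOL-Probability.Probability"
begin

text \<open>
  Conventions.  The data distribution is a probability space \<open>D\<close> whose underlying set
  \<open>space D\<close> is the sample space \<open>Z\<close>.  A sample of size \<open>N\<close> is an extensional function on
  \<open>{1..N}\<close>.  The internal randomness of the algorithm is a probability space \<open>R\<close>, and
  \<open>A S \<omega>\<close> is the parameter returned on sample \<open>S\<close> when the internal randomness is \<open>\<omega>\<close>.
  The stability condition compares \<open>A(S)\<close> and \<open>A(S')\<close> under one expectation over \<open>A\<close>,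
  so the two are evaluated at the same \<open>\<omega>\<close>; their separate laws would not determine it.
\<close>

definition sample_distr :: "'z measure \<Rightarrow> nat \<Rightarrow> (nat \<Rightarrow> 'z) measure" where
  "sample_distr D N = PiM {1..N} (\<lambda>_. D)"

definition set_power :: "'z set \<Rightarrow> nat \<Rightarrow> (nat \<Rightarrow> 'z) set" where
  "set_power B N = PiE {1..N} (\<lambda>_. B)"

text \<open>The tuple \<open>(t\<^sub>1, \<dots>, t\<^sub>i, t', t\<^sub>i\<^sub>+\<^sub>1, \<dots>, t\<^sub>N)\<close> of length \<open>N + 1\<close>, for \<open>S = (t\<^sub>1, \<dots>, t\<^sub>N)\<close>.\<close>

definition insert_after :: "nat \<Rightarrow> nat \<Rightarrow> 'z \<Rightarrow> (nat \<Rightarrow> 'z) \<Rightarrow> (nat \<Rightarrow> 'z)" where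
  "insert_after N i t' S =
     (\<lambda>j\<in>{1..N + 1}. if j \<le> i then S j else if j = i + 1 then t' else S (j - 1))"

definition empirical_error ::
  "nat \<Rightarrow> ('p \<Rightarrow> 'z \<Rightarrow> real) \<Rightarrow> (nat \<Rightarrow> 'z) \<Rightarrow> 'p \<Rightarrow> real" where
  "empirical_error N l S p = (1 / real N) * (\<Sum>n = 1..N. l p (S n))"

text \<open>
  \<open>D\<^sup>N\<close> conditioned on \<open>C\<close>: \<^const>\<open>uniform_measure\<close> \<open>M C\<close> maps \<open>X\<close> to
  \<open>M (C \<inter> X) / M C\<close>, for an arbitrary measure \<open>M\<close>.
\<close>

definition cond_sample_distr ::
  "'z measure \<Rightarrow> nat \<Rightarrow> (nat \<Rightarrow> 'z) set \<Rightarrow> (nat \<Rightarrow> 'z) measure" where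
  "cond_sample_distr D N C = uniform_measure (sample_distr D N) C"

definition cond_gen_error ::
  "'z measure \<Rightarrow> nat \<Rightarrow> ('p \<Rightarrow> 'z \<Rightarrow> real) \<Rightarrow> (nat \<Rightarrow> 'z) set \<Rightarrow> 'p \<Rightarrow> real" where
  "cond_gen_error D N l C p = (\<integral>S. empirical_error N l S p \<partial>cond_sample_distr D N C)"

text \<open>
  The stability inequality on an event \<open>E \<subseteq> Z\<^sup>N\<^sup>+\<^sup>1\<close>.  The expectation of the nonnegative
  quantity and the supremum are taken in \<^typ>\<open>ennreal\<close>, so that an infinite expectation or
  an unbounded supremum violates the bound instead of receiving a default real value.
\<close>

definition stable_on ::
  "'z measure \<Rightarrow> 'w measure \<Rightarrow> nat \<Rightarrow> ((nat \<Rightarrow> 'z) \<Rightarrow> 'w \<Rightarrow> 'p) \<Rightarrow> ('p \<Rightarrow> 'z \<Rightarrow> real) \<Rightarrow>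
     real \<Rightarrow> (nat \<Rightarrow> 'z) set \<Rightarrow> bool" where
  "stable_on D R N A l \<delta> E \<longleftrightarrow>
     (\<forall>S\<in>space (sample_distr D N). \<forall>i\<in>{1..N}. \<forall>t'\<in>space D.
        insert_after N i t' S \<in> E \<longrightarrow>
        (SUP t\<in>space D. \<integral>\<^sup>+\<omega>. ennreal \<bar>l (A S \<omega>) t - l (A (S(i := t')) \<omega>) t\<bar> \<partial>R) < ennreal \<delta>)"

text \<open>\<open>\<delta>\<close> and the event \<open>E = D\<^sub>\<epsilon>\<close> are associated with \<open>\<epsilon>\<close> in the definition of stability.\<close>

definition stability_witness ::
  "'z measure \<Rightarrow> 'w measure \<Rightarrow> nat \<Rightarrow> ((nat \<Rightarrow> 'z) \<Rightarrow> 'w \<Rightarrow> 'p) \<Rightarrow> ('p \<Rightarrow> 'z \<Rightarrow> real) \<Rightarrow>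
     real \<Rightarrow> real \<Rightarrow> (nat \<Rightarrow> 'z) set \<Rightarrow> bool" where
  "stability_witness D R N A l \<epsilon> \<delta> E \<longleftrightarrow>
     \<delta> > 0 \<and> E \<in> sets (sample_distr D (N + 1)) \<and>
     measure (sample_distr D (N + 1)) E \<ge> 1 - \<epsilon> \<and>
     stable_on D R N A l \<delta> E"

definition pac_uniformly_stable ::
  "'z measure \<Rightarrow> 'w measure \<Rightarrow> nat \<Rightarrow> ((nat \<Rightarrow> 'z) \<Rightarrow> 'w \<Rightarrow> 'p) \<Rightarrow> ('p \<Rightarrow> 'z \<Rightarrow> real) \<Rightarrow> bool"
  where
  "pac_uniformly_stable D R N A l \<longleftrightarrow>
     (\<forall>\<epsilon>\<in>{0<..<1}. \<exists>\<delta> E. stability_witness D R N A l \<epsilon> \<delta> E)"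

definition decomposable_pac_uniformly_stable ::
  "'z measure \<Rightarrow> 'w measure \<Rightarrow> nat \<Rightarrow> ((nat \<Rightarrow> 'z) \<Rightarrow> 'w \<Rightarrow> 'p) \<Rightarrow> ('p \<Rightarrow> 'z \<Rightarrow> real) \<Rightarrow> bool"
  where
  "decomposable_pac_uniformly_stable D R N A l \<longleftrightarrow>
     pac_uniformly_stable D R N A l \<and>
     (\<forall>\<epsilon>\<in>{0<..<1}. \<exists>\<delta> E. stability_witness D R N A l \<epsilon> \<delta> E \<and>
        (\<exists>B\<in>sets D. E = set_power B (N + 1)))"

end

theory Submission
  imports Defs
begin

text \<open>
  Take \<open>C = B\<^sup>N\<close>. Conditioning \<open>D\<^sup>N\<close> on \<open>C\<close> gives \<open>Q\<^sup>N\<close>, where \<open>Q\<close> is \<open>D\<close> conditioned on \<open>B\<close>, so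
  the conditional generalization error of \<open>p\<close> is the \<open>Q\<close>-mean of \<open>l p\<close>, that is, the expected loss
  at a fresh point \<open>t \<sim> Q\<close>. Exchanging \<open>t\<close> with the \<open>i\<close>-th example preserves \<open>Q\<^sup>N \<Otimes> Q\<close>, so this
  expected loss equals that of \<open>A (S(i := t))\<close> at \<open>S i\<close>, which by stability differs from that of \<open>A S\<close>
  at \<open>S i\<close> by less than \<open>\<delta>\<close>. Average over \<open>i\<close>. Only the empirical mean of the losses is assumed
  integrable; stability also yields the integrability of each summand.
\<close>

section \<open>Strict bounds on means, and conditioning on events\<close>

text \<open>Strictness survives because total mass 1 rules out \<open>f x\<close> being both below
  and at least \<open>c\<close> almost everywhere. The final bound is strict, so a weak inequality
  between means would not suffice.\<close>

lemma (in prob_space) nn_integral_less_const: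
  assumes [measurable]: "f \<in> borel_measurable M" and less: "AE x in M. f x < ennreal c"
  shows "(\<integral>\<^sup>+x. f x \<partial>M) < ennreal c"
proof -
  have le: "(\<integral>\<^sup>+x. f x \<partial>M) \<le> (\<integral>\<^sup>+x. ennreal c \<partial>M)"
    using less by (intro nn_integral_mono_AE) auto
  have const: "(\<integral>\<^sup>+x. ennreal c \<partial>M) = ennreal c"
    by (simp add: emeasure_space_1)
  have "(\<integral>\<^sup>+x. f x \<partial>M) < (\<integral>\<^sup>+x. ennreal c \<partial>M)"
  proof (rule nn_integral_less)
    show "(\<integral>\<^sup>+x. f x \<partial>M) \<noteq> \<infinity>"
      using le const by (auto simp: top_unique)
    show "AE x in M. f x \<le> ennreal c"
      using less by auto
    show "\<not> (AE x in M. ennreal c \<le> f x)"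
    proof
      assume "AE x in M. ennreal c \<le> f x"
      with less have "AE x in M. False"
        by eventually_elim auto
      then show False
        by simp
    qed
  qed simp_all
  then show ?thesis
    by (simp only: const)
qed

text \<open>Dropping the indicator of \<open>A\<close> from the conditional mean can only enlarge
  it. This carries finiteness of an integral over to the conditioned measure.\<close>

lemma nn_integral_uniform_measure_le:
  assumes [measurable]: "f \<in> borel_measurable M" "A \<in> sets M"
  shows "(\<integral>\<^sup>+x. f x \<partial>uniform_measure M A) \<le> (\<integral>\<^sup>+x. f x \<partial>M) / emeasure M A"
  by (subst nn_integral_uniform_measure)
     (auto intro!: divide_right_mono_ennreal nn_integral_mono split: split_indicator)

text \<open>A finite product measure is determined by its values on boxes, and intersecting two
  boxes acts coordinatewise. This is where decomposability enters: conditioning on a box keeps the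
  coordinates independent.\<close>

lemma uniform_measure_PiM_PiE:
  assumes "prob_space D" and I: "finite I" and B: "B \<in> sets D" "emeasure D B \<noteq> 0"
  shows "uniform_measure (PiM I (\<lambda>_. D)) (PiE I (\<lambda>_. B)) = PiM I (\<lambda>_. uniform_measure D B)"
proof -
  interpret D: prob_space D by fact
  interpret Q: prob_space "uniform_measure D B"
    using B by (intro prob_space_uniform_measure) auto
  interpret PD: product_sigma_finite "\<lambda>_. D" ..
  interpret PQ: product_sigma_finite "\<lambda>_. uniform_measure D B" ..
  have sets_eq: "sets (PiM I (\<lambda>_. uniform_measure D B)) = sets (PiM I (\<lambda>_. D))"
    by (intro sets_PiM_cong) simp_all
  show ?thesis
  proof (rule PQ.PiM_eqI[OF I])
    fix A :: "'b \<Rightarrow> 'a set" assume "\<And>i. i \<in> I \<Longrightarrow> A i \<in> sets (uniform_measure D B)"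
    then have A: "\<And>i. i \<in> I \<Longrightarrow> A i \<in> sets D"
      by simp
    have "emeasure (uniform_measure (PiM I (\<lambda>_. D)) (PiE I (\<lambda>_. B))) (PiE I A)
        = emeasure (PiM I (\<lambda>_. D)) (PiE I (\<lambda>i. B \<inter> A i)) / emeasure (PiM I (\<lambda>_. D)) (PiE I (\<lambda>_. B))"
      using A B I by (subst emeasure_uniform_measure) (auto simp: PiE_Int intro!: sets_PiM_I_finite)
    also have "\<dots> = (\<Prod>i\<in>I. emeasure D (B \<inter> A i)) / (\<Prod>i\<in>I. emeasure D B)"
      using A B I by (simp add: PD.emeasure_PiM sets.Int)
    also have "\<dots> = (\<Prod>i\<in>I. emeasure D (B \<inter> A i) / emeasure D B)"
    \<comment> \<open>With a positive denominator the quotients can be computed among real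
      probabilities, where division distributes over the product.\<close>
    proof -
      have "0 < D.prob B"
        using B by (simp add: D.emeasure_eq_measure zero_less_measure_iff)
      then show ?thesis
        by (simp add: D.emeasure_eq_measure prod_ennreal divide_ennreal prod_nonneg prod_dividef
              prod_pos ennreal_power del: prod_constant)
    qed
    also have "\<dots> = (\<Prod>i\<in>I. emeasure (uniform_measure D B) (A i))"
      using A B by (intro prod.cong) simp_all
    finally show "emeasure (uniform_measure (PiM I (\<lambda>_. D)) (PiE I (\<lambda>_. B))) (PiE I A)
        = (\<Prod>i\<in>I. emeasure (uniform_measure D B) (A i))" .
  qed (simp add: sets_eq)
qed

section \<open>Exchanging one example with an independent copy\<close>

text \<open>\<open>Q\<close> will be \<open>D\<close> conditioned on \<open>B\<close>. In the triple
  product \<open>(S_law \<Otimes>\<^sub>M R) \<Otimes>\<^sub>M Q\<close> the last factor carries the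
  fresh point.\<close>

locale iid_sample = Q: prob_space Q + R: prob_space R
  for Q :: "'z measure" and R :: "'w measure" +
  fixes I :: "'i set"
  assumes finite_I: "finite I"
begin

abbreviation "S_law \<equiv> PiM I (\<lambda>_. Q)"

sublocale PQ: product_prob_space "\<lambda>_. Q" I ..
sublocale SR: pair_prob_space S_law R ..
sublocale RQ: pair_prob_space R Q ..
sublocale SRQ: pair_prob_space "S_law \<Otimes>\<^sub>M R" Q ..

lemma measurable_replace [measurable]:
  assumes "i \<in> I" and "f \<in> measurable K S_law" and "g \<in> measurable K Q"
  shows "(\<lambda>x. (f x)(i := g x)) \<in> measurable K S_law"
  by (rule measurable_fun_upd[where J = I]) (use assms in auto)

text \<open>Both sides integrate \<open>f\<close> over all coordinates of the sample and one independent copy of the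
  \<open>i\<close>-th coordinate, in the two possible orders of these two.\<close>

lemma nn_integral_swap_replace:
  assumes i: "i \<in> I" and f: "case_prod f \<in> borel_measurable (S_law \<Otimes>\<^sub>M Q)"
  shows "(\<integral>\<^sup>+S. \<integral>\<^sup>+t. f (S(i := t)) (S i) \<partial>Q \<partial>S_law) = (\<integral>\<^sup>+S. \<integral>\<^sup>+t. f S t \<partial>Q \<partial>S_law)"
proof -
  let ?J = "I - {i}"
  interpret QQ: pair_prob_space Q Q ..
  have J: "finite ?J" "i \<notin> ?J" and I_eq: "insert i ?J = I"
    using finite_I i by auto
  note [measurable] = f i
  have upd: "(\<lambda>x. (fst x)(i := snd x)) \<in> measurable (PiM ?J (\<lambda>_. Q) \<Otimes>\<^sub>M Q) S_law"
    using measurable_add_dim[of i ?J "\<lambda>_. Q"] by (simp only: I_eq split_beta')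
  \<comment> \<open>With \<open>S = x(i := y)\<close>, overwriting coordinate \<open>i\<close>
    erases \<open>y\<close> from the sample, so \<open>S(i := t)\<close> is \<open>x(i := t)\<close>
    and \<open>S i\<close> is \<open>y\<close>.\<close>
  have "(\<integral>\<^sup>+S. \<integral>\<^sup>+t. f (S(i := t)) (S i) \<partial>Q \<partial>S_law)
      = (\<integral>\<^sup>+x. \<integral>\<^sup>+y. \<integral>\<^sup>+t. f (x(i := t)) y \<partial>Q \<partial>Q \<partial>PiM ?J (\<lambda>_. Q))"
    using PQ.product_nn_integral_insert[OF J, of "\<lambda>S. \<integral>\<^sup>+t. f (S(i := t)) (S i) \<partial>Q"]
    unfolding I_eq by simp
  also have "\<dots> = (\<integral>\<^sup>+x. \<integral>\<^sup>+y. \<integral>\<^sup>+t. f (x(i := y)) t \<partial>Q \<partial>Q \<partial>PiM ?J (\<lambda>_. Q))"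
  proof (rule nn_integral_cong)
    fix x assume x: "x \<in> space (PiM ?J (\<lambda>_. Q))"
    have [measurable]: "(\<lambda>y. x(i := y)) \<in> measurable Q S_law"
      using measurable_comp[OF measurable_Pair1'[OF x] upd] by (simp add: comp_def)
    show "(\<integral>\<^sup>+y. \<integral>\<^sup>+t. f (x(i := t)) y \<partial>Q \<partial>Q) = (\<integral>\<^sup>+y. \<integral>\<^sup>+t. f (x(i := y)) t \<partial>Q \<partial>Q)"
      by (rule QQ.Fubini') measurable
  qed
  also have "\<dots> = (\<integral>\<^sup>+S. \<integral>\<^sup>+t. f S t \<partial>Q \<partial>S_law)"
    using PQ.product_nn_integral_insert[OF J, of "\<lambda>S. \<integral>\<^sup>+t. f S t \<partial>Q"]
    unfolding I_eq by simp
  finally show ?thesis .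
qed

text \<open>Tonelli moves the integral over \<open>R\<close> innermost, the order in which stability
  is formulated: \<open>S\<close> and \<open>t\<close> are fixed and the mean is over
  \<omega>.\<close>

lemma nn_integral_sample_copy_randomness:
  assumes [measurable]: "f \<in> borel_measurable ((S_law \<Otimes>\<^sub>M R) \<Otimes>\<^sub>M Q)"
  shows "(\<integral>\<^sup>+x. f x \<partial>((S_law \<Otimes>\<^sub>M R) \<Otimes>\<^sub>M Q)) = (\<integral>\<^sup>+S. \<integral>\<^sup>+t. \<integral>\<^sup>+\<omega>. f ((S, \<omega>), t) \<partial>R \<partial>Q \<partial>S_law)"
proof -
  have "(\<integral>\<^sup>+x. f x \<partial>((S_law \<Otimes>\<^sub>M R) \<Otimes>\<^sub>M Q)) = (\<integral>\<^sup>+y. \<integral>\<^sup>+t. f (y, t) \<partial>Q \<partial>(S_law \<Otimes>\<^sub>M R))"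
    by (rule Q.nn_integral_fst[symmetric]) measurable
  also have "\<dots> = (\<integral>\<^sup>+S. \<integral>\<^sup>+\<omega>. \<integral>\<^sup>+t. f ((S, \<omega>), t) \<partial>Q \<partial>R \<partial>S_law)"
    by (rule R.nn_integral_fst[symmetric]) measurable
  also have "\<dots> = (\<integral>\<^sup>+S. \<integral>\<^sup>+t. \<integral>\<^sup>+\<omega>. f ((S, \<omega>), t) \<partial>R \<partial>Q \<partial>S_law)"
    by (intro nn_integral_cong RQ.Fubini'[symmetric]) measurable
  finally show ?thesis .
qed

text \<open>Tested on indicators, this is \<open>nn_integral_swap_replace\<close> applied to the
  mean over \<omega>. Stated for measures, it also serves signed integrable functions.\<close>

lemma distr_swap_replace:
  assumes i: "i \<in> I"
  shows "distr ((S_law \<Otimes>\<^sub>M R) \<Otimes>\<^sub>M Q) ((S_law \<Otimes>\<^sub>M R) \<Otimes>\<^sub>M Q) (\<lambda>((S, \<omega>), t). ((S(i := t), \<omega>), S i))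
       = (S_law \<Otimes>\<^sub>M R) \<Otimes>\<^sub>M Q" (is "distr ?K ?K ?T = _")
proof (rule measure_eqI)
  note [measurable] = i
  have T [measurable]: "?T \<in> measurable ?K ?K"
    unfolding split_beta' by measurable
  fix X assume "X \<in> sets (distr ?K ?K ?T)"
  then have X [measurable]: "X \<in> sets ?K"
    by simp
  have "emeasure (distr ?K ?K ?T) X = (\<integral>\<^sup>+x. indicator X x \<partial>distr ?K ?K ?T)"
    by simp
  also have "\<dots> = (\<integral>\<^sup>+x. indicator X (?T x) \<partial>?K)"
    by (rule nn_integral_distr) measurable
  also have "\<dots> = (\<integral>\<^sup>+S. \<integral>\<^sup>+t. \<integral>\<^sup>+\<omega>. indicator X ((S(i := t), \<omega>), S i) \<partial>R \<partial>Q \<partial>S_law)"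
    using nn_integral_sample_copy_randomness[OF measurable_compose[OF T borel_measurable_indicator[OF X]]]
    by simp
  also have "\<dots> = (\<integral>\<^sup>+S. \<integral>\<^sup>+t. \<integral>\<^sup>+\<omega>. indicator X ((S, \<omega>), t) \<partial>R \<partial>Q \<partial>S_law)"
    by (rule nn_integral_swap_replace[OF i, where f = "\<lambda>S t. \<integral>\<^sup>+\<omega>. indicator X ((S, \<omega>), t) \<partial>R"])
       measurable
  also have "\<dots> = emeasure ?K X"
    by (subst nn_integral_sample_copy_randomness[symmetric]) simp_all
  finally show "emeasure (distr ?K ?K ?T) X = emeasure ?K X" .
qed simp

section \<open>From replace-one stability to the gap between empirical and expected loss\<close>

text \<open>The function \<open>v\<close> is \<open>u\<close> composed with the exchange, so it is
  integrable with the same integral as \<open>u\<close>. Stability makes \<open>d\<close>, the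
  difference of \<open>w\<close> and \<open>v\<close>, small in mean absolute value. Integrability
  of \<open>w\<close> must be derived, since \<open>w\<close> evaluates \<open>u\<close> only where
  the fresh point equals \<open>S i\<close>, possibly a null set.\<close>

lemma replace_one_stability:
  fixes g :: "('i \<Rightarrow> 'z) \<Rightarrow> 'w \<Rightarrow> 'z \<Rightarrow> real"
  assumes i: "i \<in> I"
    and g: "integrable ((S_law \<Otimes>\<^sub>M R) \<Otimes>\<^sub>M Q) (\<lambda>((S, \<omega>), t). g S \<omega> t)"
    and stable: "AE S in S_law. AE t in Q.
      (\<integral>\<^sup>+\<omega>. ennreal \<bar>g S \<omega> (S i) - g (S(i := t)) \<omega> (S i)\<bar> \<partial>R) < ennreal \<delta>"
  shows "integrable (S_law \<Otimes>\<^sub>M R) (\<lambda>(S, \<omega>). g S \<omega> (S i))" (is ?int)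
    and "\<bar>(\<integral>(S, \<omega>). g S \<omega> (S i) \<partial>(S_law \<Otimes>\<^sub>M R)) - (\<integral>((S, \<omega>), t). g S \<omega> t \<partial>((S_law \<Otimes>\<^sub>M R) \<Otimes>\<^sub>M Q))\<bar> < \<delta>"
      (is ?bound)
proof -
  let ?K = "(S_law \<Otimes>\<^sub>M R) \<Otimes>\<^sub>M Q"
  define u where "u = (\<lambda>((S, \<omega>), t). g S \<omega> t)"
  define v where "v = (\<lambda>((S, \<omega>), t). g (S(i := t)) \<omega> (S i))"
  define w where "w = (\<lambda>(S, \<omega>). g S \<omega> (S i))"
  let ?T = "\<lambda>((S, \<omega>), t). ((S(i := t), \<omega>), S i)"
  note [measurable] = i
  have u: "integrable ?K u"
    using g by (simp add: u_def)
  then have [measurable]: "u \<in> borel_measurable ?K"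
    by simp
  have T [measurable]: "?T \<in> measurable ?K ?K"
    unfolding split_beta' by measurable
  have v_eq: "v = (\<lambda>x. u (?T x))"
    by (auto simp: u_def v_def)
  have "integrable (distr ?K ?K ?T) u"
    using u by (simp only: distr_swap_replace[OF i])
  then have v: "integrable ?K v"
    unfolding v_eq by (rule integrable_distr[OF T])
  have int_v: "integral\<^sup>L ?K v = integral\<^sup>L ?K u"
  proof -
    have "integral\<^sup>L ?K v = integral\<^sup>L (distr ?K ?K ?T) u"
      unfolding v_eq by (rule integral_distr[symmetric]) measurable
    then show ?thesis
      by (simp only: distr_swap_replace[OF i])
  qed
  have w_eq: "w = (\<lambda>x. u (x, fst x i))"
    by (auto simp: u_def w_def)
  have w_meas [measurable]: "w \<in> borel_measurable (S_law \<Otimes>\<^sub>M R)"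
    unfolding w_eq by measurable
  have [measurable]: "v \<in> borel_measurable ?K"
    using v by simp
  define d where "d = (\<lambda>x. w (fst x) - v x)"
  have d_meas [measurable]: "d \<in> borel_measurable ?K"
    unfolding d_def by measurable
  have "(\<integral>\<^sup>+x. ennreal \<bar>d x\<bar> \<partial>?K) = (\<integral>\<^sup>+S. \<integral>\<^sup>+t. \<integral>\<^sup>+\<omega>. ennreal \<bar>d ((S, \<omega>), t)\<bar> \<partial>R \<partial>Q \<partial>S_law)"
    by (rule nn_integral_sample_copy_randomness) measurable
  also have "\<dots> < ennreal \<delta>"
  proof (rule PQ.nn_integral_less_const)
    show "AE S in S_law. (\<integral>\<^sup>+t. \<integral>\<^sup>+\<omega>. ennreal \<bar>d ((S, \<omega>), t)\<bar> \<partial>R \<partial>Q) < ennreal \<delta>"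
      using stable
    \<comment> \<open>This form keeps \<open>S\<close> in the space of \<open>S_law\<close>, where
      the sections of \<open>d\<close> at \<open>S\<close> are measurable.\<close>
    proof (rule AE_mp, intro AE_I2 impI)
      fix S assume [measurable]: "S \<in> space S_law"
        and "AE t in Q. (\<integral>\<^sup>+\<omega>. ennreal \<bar>g S \<omega> (S i) - g (S(i := t)) \<omega> (S i)\<bar> \<partial>R) < ennreal \<delta>"
      then show "(\<integral>\<^sup>+t. \<integral>\<^sup>+\<omega>. ennreal \<bar>d ((S, \<omega>), t)\<bar> \<partial>R \<partial>Q) < ennreal \<delta>"
        by (intro Q.nn_integral_less_const) (measurable, simp add: d_def v_def w_def)
    qed
  qed measurable
  finally have d_less: "(\<integral>\<^sup>+x. ennreal \<bar>d x\<bar> \<partial>?K) < ennreal \<delta>" .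
  have d: "integrable ?K d"
    using d_less by (intro integrableI_bounded) (auto intro: less_trans)
  \<comment> \<open>A value strictly below \<open>ennreal \<delta>\<close> forces \<delta> to be
    positive, so the bound passes to the reals.\<close>
  have d_bound: "\<bar>integral\<^sup>L ?K d\<bar> < \<delta>"
    using integral_norm_bound_ennreal[OF d] d_less by (auto simp: ennreal_less_iff dest: le_less_trans)
  have "integrable ?K (\<lambda>x. d x + v x)"
    using d v by (rule Bochner_Integration.integrable_add)
  then have w_K: "integrable ?K (\<lambda>x. w (fst x))"
    by (simp add: d_def)
  \<comment> \<open>\<open>w (fst x)\<close> is constant in the fresh point and \<open>Q\<close> has
    mass 1, so the last factor integrates out.\<close>
  have w: "integrable (S_law \<Otimes>\<^sub>M R) w" and int_w: "(\<integral>x. w (fst x) \<partial>?K) = integral\<^sup>L (S_law \<Otimes>\<^sub>M R) w"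
    using SRQ.integrable_fst'[OF w_K] SRQ.integral_fst'[OF w_K] by (simp_all add: Q.prob_space)
  from w show ?int
    by (simp add: w_def)
  have "integral\<^sup>L ?K d = integral\<^sup>L (S_law \<Otimes>\<^sub>M R) w - integral\<^sup>L ?K u"
    unfolding d_def by (simp add: w_K v int_w int_v)
  with d_bound show ?bound
    by (simp add: w_def u_def)
qed

text \<open>The fresh-point mean \<open>U\<close> is common to all \<open>i\<close>, so the gap is
  the average of the differences \<open>W i - U\<close>, each of absolute value below
  \<delta>.\<close>

lemma mean_replace_one_stability:
  fixes g :: "('i \<Rightarrow> 'z) \<Rightarrow> 'w \<Rightarrow> 'z \<Rightarrow> real"
  assumes I: "I \<noteq> {}"
    and g: "integrable ((S_law \<Otimes>\<^sub>M R) \<Otimes>\<^sub>M Q) (\<lambda>((S, \<omega>), t). g S \<omega> t)"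
    and stable: "\<And>i. i \<in> I \<Longrightarrow> AE S in S_law. AE t in Q.
      (\<integral>\<^sup>+\<omega>. ennreal \<bar>g S \<omega> (S i) - g (S(i := t)) \<omega> (S i)\<bar> \<partial>R) < ennreal \<delta>"
  shows "\<bar>\<integral>S. (\<integral>\<omega>. (\<Sum>i\<in>I. g S \<omega> (S i)) / card I - (\<integral>t. g S \<omega> t \<partial>Q) \<partial>R) \<partial>S_law\<bar> < \<delta>"
proof -
  let ?SR = "S_law \<Otimes>\<^sub>M R"
  define U where "U = (\<integral>((S, \<omega>), t). g S \<omega> t \<partial>(?SR \<Otimes>\<^sub>M Q))"
  define W where "W i = (\<integral>(S, \<omega>). g S \<omega> (S i) \<partial>?SR)" for i
  \<comment> \<open>The paired abstractions stay applied to \<open>x\<close> and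
    \<open>(x, t)\<close> so that the terms match the integrability facts and Fubini rules used
    below.\<close>
  define h where "h = (\<lambda>x. (\<Sum>i\<in>I. (\<lambda>(S, \<omega>). g S \<omega> (S i)) x) / card I - (\<integral>t. (\<lambda>((S, \<omega>), t). g S \<omega> t) (x, t) \<partial>Q))"
  have card: "0 < card I"
    using I finite_I by (simp add: card_gt_0_iff)
  note w = replace_one_stability(1)[OF _ g stable]
  have WU: "\<bar>W i - U\<bar> < \<delta>" if "i \<in> I" for i
    using replace_one_stability(2)[OF that g stable[OF that]] by (simp add: W_def U_def)
  have sum: "integrable ?SR (\<lambda>x. (\<Sum>i\<in>I. (\<lambda>(S, \<omega>). g S \<omega> (S i)) x) / card I)"
    using w by (intro integrable_divide Bochner_Integration.integrable_sum) auto
  note fst = SRQ.integrable_fst'[OF g]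
  have h: "integrable ?SR h"
    unfolding h_def using sum fst by (rule Bochner_Integration.integrable_diff)
  have "integral\<^sup>L ?SR h = (\<Sum>i\<in>I. W i) / card I - U"
    unfolding h_def W_def U_def
    by (subst Bochner_Integration.integral_diff[OF sum fst], subst SRQ.integral_fst'[OF g])
       (simp add: Bochner_Integration.integral_sum w)
  also have "\<dots> = (\<Sum>i\<in>I. W i - U) / card I"
    using card by (simp add: sum_subtractf field_simps)
  finally have "\<bar>integral\<^sup>L ?SR h\<bar> = \<bar>\<Sum>i\<in>I. W i - U\<bar> / card I"
    by simp
  also have "\<dots> \<le> (\<Sum>i\<in>I. \<bar>W i - U\<bar>) / card I"
    by (intro divide_right_mono sum_abs) simp
  \<comment> \<open>Nonemptiness of \<open>I\<close> keeps the inequality strict.\<close>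
  also have "\<dots> < (\<Sum>i\<in>I. \<delta>) / card I"
    using card I finite_I WU by (intro divide_strict_right_mono sum_strict_mono) auto
  also have "\<dots> = \<delta>"
    using card by simp
  finally have "\<bar>integral\<^sup>L ?SR h\<bar> < \<delta>" .
  moreover have "integral\<^sup>L ?SR h = (\<integral>S. \<integral>\<omega>. h (S, \<omega>) \<partial>R \<partial>S_law)"
    by (rule SR.integral_fst'[OF h, symmetric])
  ultimately show ?thesis
    by (simp add: h_def)
qed

text \<open>Each coordinate has law \<open>Q\<close>. Applied to the loss of a fixed parameter, this
  identifies the conditional generalization error with a fresh-point mean.\<close>

lemma integral_sample_mean:
  fixes f :: "'z \<Rightarrow> real"
  assumes I: "I \<noteq> {}" and f: "integrable Q f"
  shows "(\<integral>S. (\<Sum>i\<in>I. f (S i)) / card I \<partial>S_law) = (\<integral>t. f t \<partial>Q)"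
proof -
  have component: "distr S_law Q (\<lambda>S. S i) = Q" if "i \<in> I" for i
    using that by (rule PQ.PiM_component)
  have int: "integrable S_law (\<lambda>S. f (S i))" if "i \<in> I" for i
    using that f by (subst integrable_distr_eq[of "\<lambda>S. S i" S_law Q, symmetric]) (simp_all add: component)
  have eq: "(\<integral>S. f (S i) \<partial>S_law) = (\<integral>t. f t \<partial>Q)" if "i \<in> I" for i
    using that f integral_distr[of "\<lambda>S. S i" S_law Q f] by (simp add: component)
  have "(\<integral>S. (\<Sum>i\<in>I. f (S i)) / card I \<partial>S_law) = (\<Sum>i\<in>I. \<integral>S. f (S i) \<partial>S_law) / card I"
    by (simp add: int)
  also have "\<dots> = (\<integral>t. f t \<partial>Q)"
    using I finite_I by (simp add: eq card_gt_0_iff)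
  finally show ?thesis .
qed

end

section \<open>Application to the conditioned sample\<close>

text \<open>Every entry of the longer tuple is \<open>t\<close> or an entry of \<open>S\<close>,
  wherever \<open>t\<close> is inserted. This supplies the premise of
  \<open>stable_on\<close>.\<close>

lemma insert_after_mem_set_power:
  assumes "S \<in> set_power B N" and "t \<in> B" and "i \<in> {1..N}"
  shows "insert_after N i t S \<in> set_power B (N + 1)"
proof -
  have S: "S k \<in> B" if "k \<in> {1..N}" for k
    using that assms by (auto simp: set_power_def)
  have "insert_after N i t S j \<in> B" if "j \<in> {1..N + 1}" for j
  proof -
    \<comment> \<open>Beyond the inserted entry \<open>S\<close> is read one place earlier; the
      bounds on \<open>i\<close> keep both index ranges within \<open>{1..N}\<close>.\<close>
    have "j \<le> i \<Longrightarrow> j \<in> {1..N}" and "i + 1 < j \<Longrightarrow> j - 1 \<in> {1..N}"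
      using that assms(3) by auto
    then show ?thesis
      using that \<open>t \<in> B\<close> S unfolding insert_after_def by (cases j "i + 1" rule: linorder_cases) auto
  qed
  then show ?thesis
    by (auto simp: set_power_def PiE_iff insert_after_def)
qed

theorem theorem4p2:
  fixes D :: "'z measure" and R :: "'w measure" and P :: "'p measure"
    and N :: nat and A :: "(nat \<Rightarrow> 'z) \<Rightarrow> 'w \<Rightarrow> 'p" and l :: "'p \<Rightarrow> 'z \<Rightarrow> real"
    and \<epsilon> \<delta> :: real and B :: "'z set"
  assumes "prob_space D" and "prob_space R" and "N \<ge> 1"
    and "(\<lambda>(S, \<omega>). A S \<omega>) \<in> measurable (sample_distr D N \<Otimes>\<^sub>M R) P"
    and "(\<lambda>(p, t). l p t) \<in> borel_measurable (P \<Otimes>\<^sub>M D)"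
    and "integrable (sample_distr D N \<Otimes>\<^sub>M R) (\<lambda>(S, \<omega>). empirical_error N l S (A S \<omega>))"
    and "integrable ((sample_distr D N \<Otimes>\<^sub>M R) \<Otimes>\<^sub>M D) (\<lambda>((S, \<omega>), t). l (A S \<omega>) t)"
    and "decomposable_pac_uniformly_stable D R N A l"
    and "0 < \<epsilon>" and "\<epsilon> < 1"
    and "B \<in> sets D"
    and "stability_witness D R N A l \<epsilon> \<delta> (set_power B (N + 1))"
  shows "\<exists>C\<in>sets (sample_distr D N).
           measure (sample_distr D N) C \<ge> 1 - \<epsilon> \<and>
           \<bar>\<integral>S. (\<integral>\<omega>. empirical_error N l S (A S \<omega>) - cond_gen_error D N l C (A S \<omega>) \<partial>R)
              \<partial>cond_sample_distr D N C\<bar> < \<delta>"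
proof -
  define M where "M = sample_distr D N"
  define C where "C = set_power B N"
  define Q where "Q = uniform_measure D B"
  interpret D: prob_space D by fact
  interpret R: prob_space R by fact
  interpret PD: finite_product_prob_space "\<lambda>_. D" "{1..N}"
    by standard simp
  interpret PD1: finite_product_prob_space "\<lambda>_. D" "{1..N + 1}"
    by standard simp
  note B = \<open>B \<in> sets D\<close>
  have prob_B1: "1 - \<epsilon> \<le> D.prob B ^ (N + 1)"
    and stable: "stable_on D R N A l \<delta> (set_power B (N + 1))"
    using \<open>stability_witness D R N A l \<epsilon> \<delta> (set_power B (N + 1))\<close> PD1.prob_times[of "\<lambda>_. B"] B
    by (simp_all add: stability_witness_def sample_distr_def set_power_def)
  have C: "C \<in> sets M"
    using B by (simp add: C_def M_def set_power_def sample_distr_def)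
  have prob_C: "measure M C = D.prob B ^ N"
    using PD.prob_times[of "\<lambda>_. B"] B by (simp add: C_def M_def set_power_def sample_distr_def)
  \<comment> \<open>The stability event has one factor more than \<open>C\<close>; that factor is at
    most 1.\<close>
  have "D.prob B ^ (N + 1) \<le> D.prob B ^ N"
    by (intro power_decreasing) simp_all
  with prob_B1 prob_C have C_ge: "1 - \<epsilon> \<le> measure M C"
    by simp
  \<comment> \<open>Were this probability 0, its power would be 0, below
    \<open>1 - \<epsilon>\<close>. Hence conditioning on \<open>B\<close> and on \<open>C\<close> is
    meaningful.\<close>
  have B_pos: "0 < D.prob B"
    using prob_B1 \<open>\<epsilon> < 1\<close> by (cases "D.prob B = 0") (auto simp: zero_less_measure_iff)
  then have B_nz: "emeasure D B \<noteq> 0"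
    by (simp add: D.emeasure_eq_measure)
  have C_nz: "emeasure M C \<noteq> 0"
    using B_pos prob_C by (auto simp: measure_def)
  have sets_Q: "sets Q = sets D"
    by (simp add: Q_def)
  have law: "cond_sample_distr D N C = PiM {1..N} (\<lambda>_. Q)"
    using uniform_measure_PiM_PiE[OF \<open>prob_space D\<close> _ B B_nz, of "{1..N}"]
    by (simp add: cond_sample_distr_def sample_distr_def C_def set_power_def Q_def)
  then have law': "uniform_measure M C = PiM {1..N} (\<lambda>_. Q)"
    by (simp add: cond_sample_distr_def M_def)
  interpret Q: prob_space Q
    unfolding Q_def using B_nz by (intro prob_space_uniform_measure) auto
  interpret iid_sample Q R "{1..N}"
    by standard simp
  have sets_law: "sets S_law = sets M"
    using law' by (metis sets_uniform_measure)
  have N: "{1..N} \<noteq> {}"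
    using \<open>N \<ge> 1\<close> by simp
  note [measurable_cong] = sets_Q
  note l [measurable] = \<open>(\<lambda>(p, t). l p t) \<in> borel_measurable (P \<Otimes>\<^sub>M D)\<close>
  have gen_meas [measurable]: "cond_gen_error D N l C \<in> borel_measurable P"
    unfolding cond_gen_error_def empirical_error_def law by measurable
  note [measurable_cong] = sets_law
  have A [measurable]: "(\<lambda>(S, \<omega>). A S \<omega>) \<in> measurable (M \<Otimes>\<^sub>M R) P"
    using assms(4) by (simp add: M_def)
  define u where "u = (\<lambda>((S, \<omega>), t). l (A S \<omega>) t)"
  have u_int: "integrable ((M \<Otimes>\<^sub>M R) \<Otimes>\<^sub>M D) u"
    using assms(7) by (simp add: u_def M_def)
  then have u_meas [measurable]: "u \<in> borel_measurable ((M \<Otimes>\<^sub>M R) \<Otimes>\<^sub>M D)"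
    by simp
  have u_law_meas: "u \<in> borel_measurable ((S_law \<Otimes>\<^sub>M R) \<Otimes>\<^sub>M Q)"
    by measurable
  \<comment> \<open>Conditioning the sample and the fresh point divides the integral by at most the
    probabilities of \<open>C\<close> and \<open>B\<close>, both nonzero, so finiteness is
    inherited.\<close>
  have "(\<integral>\<^sup>+x. ennreal \<bar>u x\<bar> \<partial>((S_law \<Otimes>\<^sub>M R) \<Otimes>\<^sub>M Q))
      = (\<integral>\<^sup>+S. \<integral>\<^sup>+\<omega>. \<integral>\<^sup>+t. ennreal \<bar>u ((S, \<omega>), t)\<bar> \<partial>Q \<partial>R \<partial>S_law)"
    by (subst R.nn_integral_fst, measurable, subst Q.nn_integral_fst, measurable)
  also have "\<dots> \<le> (\<integral>\<^sup>+S. \<integral>\<^sup>+\<omega>. \<integral>\<^sup>+t. ennreal \<bar>u ((S, \<omega>), t)\<bar> \<partial>Q \<partial>R \<partial>M) / emeasure M C"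
    unfolding law'[symmetric] using C by (intro nn_integral_uniform_measure_le) measurable
  also have "\<dots> \<le> (\<integral>\<^sup>+S. \<integral>\<^sup>+\<omega>. (\<integral>\<^sup>+t. ennreal \<bar>u ((S, \<omega>), t)\<bar> \<partial>D) / emeasure D B \<partial>R \<partial>M) / emeasure M C"
    unfolding Q_def using B
    by (intro divide_right_mono_ennreal nn_integral_mono nn_integral_uniform_measure_le) measurable
  also have "\<dots> = (\<integral>\<^sup>+S. (\<integral>\<^sup>+\<omega>. \<integral>\<^sup>+t. ennreal \<bar>u ((S, \<omega>), t)\<bar> \<partial>D \<partial>R) / emeasure D B \<partial>M) / emeasure M C"
    by (intro arg_cong2[where f = "(/)"] refl nn_integral_cong nn_integral_divide) measurable
  also have "\<dots> = (\<integral>\<^sup>+S. \<integral>\<^sup>+\<omega>. \<integral>\<^sup>+t. ennreal \<bar>u ((S, \<omega>), t)\<bar> \<partial>D \<partial>R \<partial>M) / emeasure D B / emeasure M C"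
    by (intro arg_cong2[where f = "(/)"] refl nn_integral_divide) measurable
  also have "\<dots> = (\<integral>\<^sup>+x. ennreal \<bar>u x\<bar> \<partial>((M \<Otimes>\<^sub>M R) \<Otimes>\<^sub>M D)) / emeasure D B / emeasure M C"
    by (subst R.nn_integral_fst, measurable, subst D.nn_integral_fst, measurable)
  also have "\<dots> < \<infinity>"
    using u_int B_nz C_nz by (simp add: integrable_iff_bounded ennreal_divide_eq_top_iff less_top[symmetric])
  finally have u_law: "integrable ((S_law \<Otimes>\<^sub>M R) \<Otimes>\<^sub>M Q) u"
    by (intro integrableI_bounded u_law_meas) simp
  \<comment> \<open>The conditioned laws are concentrated on \<open>C\<close> and \<open>B\<close>,
    where the stability inequality applies; its supremum dominates the value at
    \<open>S i\<close>.\<close>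
  have stable_AE: "AE S in S_law. AE t in Q.
      (\<integral>\<^sup>+\<omega>. ennreal \<bar>l (A S \<omega>) (S i) - l (A (S(i := t)) \<omega>) (S i)\<bar> \<partial>R) < ennreal \<delta>"
    if i: "i \<in> {1..N}" for i
  proof -
    have less: "(\<integral>\<^sup>+\<omega>. ennreal \<bar>l (A S \<omega>) (S i) - l (A (S(i := t)) \<omega>) (S i)\<bar> \<partial>R) < ennreal \<delta>"
      if S: "S \<in> C" and t: "t \<in> B" for S t
    proof -
      have space: "S \<in> space M" "t \<in> space D"
        using S t sets.sets_into_space[OF C] sets.sets_into_space[OF B] by auto
      then have "S i \<in> space D"
        using i by (auto simp: M_def sample_distr_def space_PiM)
      then have "(\<integral>\<^sup>+\<omega>. ennreal \<bar>l (A S \<omega>) (S i) - l (A (S(i := t)) \<omega>) (S i)\<bar> \<partial>R)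
          \<le> (SUP z\<in>space D. \<integral>\<^sup>+\<omega>. ennreal \<bar>l (A S \<omega>) z - l (A (S(i := t)) \<omega>) z\<bar> \<partial>R)"
        by (intro SUP_upper2[of "S i"]) simp_all
      also have "\<dots> < ennreal \<delta>"
        using stable space i insert_after_mem_set_power[OF S[unfolded C_def] t i]
        by (simp only: stable_on_def M_def)
      finally show ?thesis .
    qed
    show ?thesis
      unfolding law'[symmetric]
    proof (rule AE_uniform_measureI[OF C], rule AE_I2, rule impI)
      fix S assume "S \<in> C"
      then show "AE t in Q. (\<integral>\<^sup>+\<omega>. ennreal \<bar>l (A S \<omega>) (S i) - l (A (S(i := t)) \<omega>) (S i)\<bar> \<partial>R) < ennreal \<delta>"
        unfolding Q_def by (intro AE_uniform_measureI[OF B] AE_I2 impI less)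
    qed
  qed
  have cond_gen: "cond_gen_error D N l C p = (\<integral>t. l p t \<partial>Q)" if "integrable Q (l p)" for p
    using integral_sample_mean[OF N that]
    by (simp add: cond_gen_error_def empirical_error_def law)
  \<comment> \<open>\<open>f\<close> is the integrand of the claim and \<open>h\<close> that of
    \<open>mean_replace_one_stability\<close>. They are compared only almost everywhere: Fubini
    makes the loss of \<open>A S \<omega>\<close> integrable over \<open>Q\<close> for almost all
    \<open>S\<close> and \<omega>, and \<open>cond_gen\<close> requires this.\<close>
  define f where "f S \<omega> = empirical_error N l S (A S \<omega>) - cond_gen_error D N l C (A S \<omega>)" for S \<omega>
  define h where "h S \<omega> = (\<Sum>i\<in>{1..N}. l (A S \<omega>) (S i)) / card {1..N} - (\<integral>t. l (A S \<omega>) t \<partial>Q)" for S \<omega>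
  have "AE x in S_law \<Otimes>\<^sub>M R. integrable Q (\<lambda>t. u (x, t))"
    by (rule SRQ.AE_integrable_fst'[OF u_law])
  then have "AE S in S_law. AE \<omega> in R. integrable Q (l (A S \<omega>))"
    using SR.AE_pair by (fastforce simp: u_def)
  then have AE_eq: "AE S in S_law. AE \<omega> in R. f S \<omega> = h S \<omega>"
  proof eventually_elim
    case (elim S)
    then show ?case
      by eventually_elim (simp add: f_def h_def cond_gen empirical_error_def)
  qed
  have emp_meas [measurable]: "(\<lambda>(S, \<omega>). empirical_error N l S (A S \<omega>)) \<in> borel_measurable (M \<Otimes>\<^sub>M R)"
    using assms(6) by (simp add: M_def)
  have f: "case_prod f \<in> borel_measurable (S_law \<Otimes>\<^sub>M R)"
  proof -
    have "(\<lambda>x. (\<lambda>(S, \<omega>). empirical_error N l S (A S \<omega>)) x - cond_gen_error D N l C ((\<lambda>(S, \<omega>). A S \<omega>) x))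
        \<in> borel_measurable (S_law \<Otimes>\<^sub>M R)"
      by measurable
    then show ?thesis
      by (simp only: f_def split_beta')
  qed
  have h: "case_prod h \<in> borel_measurable (S_law \<Otimes>\<^sub>M R)"
  proof -
    have component: "(\<lambda>x. fst x i) \<in> measurable (S_law \<Otimes>\<^sub>M R) Q" if "i \<in> {1..N}" for i
      using that by (intro measurable_compose[OF measurable_fst]) simp
    have "(\<lambda>x. u (x, fst x i)) \<in> borel_measurable (S_law \<Otimes>\<^sub>M R)" if "i \<in> {1..N}" for i
      using u_law_meas component[OF that] by measurable
    then have "(\<lambda>x. (\<Sum>i\<in>{1..N}. u (x, fst x i)) / card {1..N} - (\<integral>t. u (x, t) \<partial>Q))
        \<in> borel_measurable (S_law \<Otimes>\<^sub>M R)"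
      using u_law_meas by measurable
    then show ?thesis
      by (simp only: h_def u_def split_beta' fst_conv snd_conv)
  qed
  \<comment> \<open>The congruence is applied for \<omega> and then for \<open>S\<close>; both times
    it needs measurability of the two integrands, hence the joint measurability of \<open>f\<close>
    and \<open>h\<close>.\<close>
  have "(\<integral>S. (\<integral>\<omega>. f S \<omega> \<partial>R) \<partial>S_law) = (\<integral>S. (\<integral>\<omega>. h S \<omega> \<partial>R) \<partial>S_law)" (is "?lhs = ?rhs")
  proof (rule integral_cong_AE)
    show "AE S in S_law. (\<integral>\<omega>. f S \<omega> \<partial>R) = (\<integral>\<omega>. h S \<omega> \<partial>R)"
      using AE_eq
    proof (rule AE_mp, intro AE_I2 impI)
      fix S assume S: "S \<in> space S_law"
        and "AE \<omega> in R. f S \<omega> = h S \<omega>"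
      then show "(\<integral>\<omega>. f S \<omega> \<partial>R) = (\<integral>\<omega>. h S \<omega> \<partial>R)"
        using measurable_Pair2[OF f S] measurable_Pair2[OF h S]
        by (intro integral_cong_AE) (simp_all only: case_prod_conv)
    qed
  qed (use f h in measurable)
  moreover have "\<bar>?rhs\<bar> < \<delta>"
    using mean_replace_one_stability[OF N, of "\<lambda>S \<omega>. l (A S \<omega>)"] u_law stable_AE
    by (simp add: u_def h_def)
  ultimately have "\<bar>?lhs\<bar> < \<delta>"
    by simp
  with C C_ge show ?thesis
    by (auto simp: M_def law f_def)
qed

end
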